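(* Let $k\geq 2$ be an integer and let $\{b_k(n)\}_{n=0}^\infty$ be the Bell numbers of order $k$. Then $$b_k(n)\,b_k(m)\leq b_k(n+m)\leq \binom{n+m}{n} b_k(n)\,b_k(m)\quad\text{for all } n,m\geq 0.$$
   Context: For an integer $k\geq 2$, let $\exp_k(x)$ denote the $k$-times iterated exponential $\exp(\exp(\cdots\exp(x)\cdots))$ ($k$ exponentials). Define $B_k(n)$ by the power series $\exp_k(x)=\sum_{n=0}^\infty \frac{B_k(n)}{n!}x^n$. The Bell numbers of order $k$ are $b_k(n)=B_k(n)/\exp_k(0)$, $n\geq 0$. *)

theory Defs
  imports "HOL-Complex_Analysis.Complex_Analysis"
begin

definition iter_exp :: "nat \<Rightarrow> real \<Rightarrow> real" where
  "iter_exp k = exp ^^ k"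

text \<open>
  \<open>bell_numer k\<close> is the coefficient sequence \<open>B\<^sub>k\<close> of the exponential power series of \<open>iter_exp k\<close>.
  Lemmas \<open>ex1_bell_numer\<close> and \<open>bell_numer_sums\<close> show that the description is proper.
\<close>

definition bell_numer :: "nat \<Rightarrow> nat \<Rightarrow> real" where
  "bell_numer k = (THE B. \<forall>x. (\<lambda>n. B n / fact n * x ^ n) sums iter_exp k x)"

definition bell_order :: "nat \<Rightarrow> nat \<Rightarrow> real" where
  "bell_order k n = bell_numer k n / iter_exp k 0"

lemma ex1_bell_numer: "\<exists>!B. \<forall>x. (\<lambda>n. B n / fact n * x ^ n) sums iter_exp k x"
proof (rule ex_ex1I)
  define f :: "complex \<Rightarrow> complex" where "f = exp ^^ k"
  have holo: "f holomorphic_on UNIV"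
    unfolding f_def by (induction k) (auto intro!: holomorphic_intros simp: o_def id_def)
  have f_real: "f (of_real x) = of_real (iter_exp k x)" for x
    unfolding f_def iter_exp_def by (induction k) (auto simp: exp_of_real)
  have "(\<lambda>n. Re ((deriv ^^ n) f 0) / fact n * x ^ n) sums iter_exp k x" for x :: real
  proof -
    have "(\<lambda>n. (deriv ^^ n) f 0 / fact n * (of_real x - 0) ^ n) sums f (of_real x)"
      by (rule holomorphic_power_series[where r = "\<bar>x\<bar> + 1"])
         (auto intro: holomorphic_on_subset[OF holo])
    from sums_Re[OF this]
    have "(\<lambda>n. Re ((deriv ^^ n) f 0 / fact n * of_real x ^ n)) sums iter_exp k x"
      by (simp add: f_real)
    moreover have "Re ((deriv ^^ n) f 0 / fact n * of_real x ^ n)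
        = Re ((deriv ^^ n) f 0) / fact n * x ^ n" for n
    proof -
      have "(deriv ^^ n) f 0 / fact n * of_real x ^ n
          = (deriv ^^ n) f 0 * of_real (x ^ n / fact n)"
        by simp
      then show ?thesis
        by (simp del: of_real_divide of_real_power)
    qed
    ultimately show ?thesis by simp
  qed
  then show "\<exists>B. \<forall>x. (\<lambda>n. B n / fact n * x ^ n) sums iter_exp k x"
    by (intro exI[of _ "\<lambda>n. Re ((deriv ^^ n) f 0)"]) auto
next
  fix B C :: "nat \<Rightarrow> real"
  assume B: "\<forall>x. (\<lambda>n. B n / fact n * x ^ n) sums iter_exp k x"
    and C: "\<forall>x. (\<lambda>n. C n / fact n * x ^ n) sums iter_exp k x"
  define a where "a = (\<lambda>n. B n / fact n - C n / fact n)"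
  have a: "(\<lambda>n. a n * x ^ n) sums 0" for x
    using sums_diff[OF B[rule_format, of x] C[rule_format, of x]]
    by (simp add: a_def algebra_simps)
  have "a n = 0" for n
  proof (rule ccontr)
    assume "a n \<noteq> 0"
    with a[of 0] have "n > 0" by (cases n) auto
    obtain s where "s > 0" and s: "\<And>z :: real. z \<in> cball 0 s - {0} \<Longrightarrow> (0 :: real) \<noteq> 0"
      by (rule powser_0_nonzero[of 1 0 a "\<lambda>_. 0" n]) (use a \<open>a n \<noteq> 0\<close> \<open>n > 0\<close> in auto)
    from s[of s] \<open>s > 0\<close> show False by simp
  qed
  then have "B n = C n" for n
    by (simp add: a_def)
  then show "B = C" by auto
qed

lemma bell_numer_sums: "(\<lambda>n. bell_numer k n / fact n * x ^ n) sums iter_exp k x"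
  using theI'[OF ex1_bell_numer[of k]] unfolding bell_numer_def by blast

end

theory Submission
  imports Defs
begin

text \<open>
  Write \<open>F\<close> for the power series of \<open>exp\<^sub>k\<^sub>+\<^sub>1\<close> and \<open>G\<close> for the derivative of that of \<open>exp\<^sub>k\<close>, so that
  \<open>F' = F G\<close> and all coefficients are nonnegative.

  Lower bound: \<open>F\<close> divides its own derivatives, \<open>F\<^sup>(\<^sup>n\<^sup>) = F P\<^sub>n\<close> with \<open>P\<^sub>0 = 1\<close> and
  \<open>P\<^sub>n\<^sub>+\<^sub>1 = P\<^sub>n' + P\<^sub>n G\<close>, and \<open>b(n) = P\<^sub>n(0)\<close>.  By induction on \<open>m\<close> the series
  \<open>P\<^sub>n\<^sub>+\<^sub>m - P\<^sub>n P\<^sub>m\<close> has nonnegative coefficients.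

  Upper bound: the normalised coefficients \<open>a(n) = b(n) / n!\<close> satisfy
  \<open>n a(n) = \<Sum>j=1..n. x(j) a(n - j)\<close>, where \<open>x(j)\<close> is \<open>j\<close> times the \<open>j\<close>-th coefficient of \<open>exp\<^sub>k\<close>.
  Submultiplicativity of \<open>x\<close> (with \<open>x(0)\<close> set to 1) passes to \<open>a\<close>.  It holds for \<open>k = 1\<close>
  because \<open>x(j) = 1 / (j - 1)!\<close>; for \<open>k \<ge> 2\<close> it follows from submultiplicativity one level below
  since \<open>exp\<^sub>k(0) \<ge> 2\<close> and \<open>i + j \<le> 2 i j\<close>.
\<close>

section \<open>Nonnegative solutions of F' = F G and the lower bound\<close>

definition fps_nonneg :: "real fps \<Rightarrow> bool" where
  "fps_nonneg f \<longleftrightarrow> (\<forall>n. fps_nth f n \<ge> 0)"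

lemma fps_nonneg_1: "fps_nonneg 1"
  by (simp add: fps_nonneg_def)

lemma fps_nonneg_add: "fps_nonneg f \<Longrightarrow> fps_nonneg g \<Longrightarrow> fps_nonneg (f + g)"
  by (simp add: fps_nonneg_def)

lemma fps_nonneg_mult: "fps_nonneg f \<Longrightarrow> fps_nonneg g \<Longrightarrow> fps_nonneg (f * g)"
  by (simp add: fps_nonneg_def fps_mult_nth sum_nonneg)

lemma fps_nonneg_deriv: "fps_nonneg f \<Longrightarrow> fps_nonneg (fps_deriv f)"
  by (simp add: fps_nonneg_def)

text \<open>The complete Bell polynomial in \<open>G\<close> and its derivatives: for F = exp(g) and
  \<open>G\<close> = g' it is the \<open>n\<close>-th derivative of F divided by F.\<close>

fun log_deriv_power :: "real fps \<Rightarrow> nat \<Rightarrow> real fps" where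
  "log_deriv_power G 0 = 1"
| "log_deriv_power G (Suc n) = fps_deriv (log_deriv_power G n) + log_deriv_power G n * G"

lemma higher_fps_deriv_eq:
  assumes "fps_deriv F = F * G"
  shows "(fps_deriv ^^ n) F = F * log_deriv_power G n"
  by (induction n) (simp_all add: assms algebra_simps)

lemma fps_nonneg_log_deriv_power: "fps_nonneg G \<Longrightarrow> fps_nonneg (log_deriv_power G n)"
  by (induction n) (auto intro: fps_nonneg_1 fps_nonneg_add fps_nonneg_mult fps_nonneg_deriv)

lemma log_deriv_power_supermult:
  assumes "fps_nonneg G"
  shows "fps_nonneg (log_deriv_power G (n + m) - log_deriv_power G n * log_deriv_power G m)"
proof (induction m)
  case 0
  show ?case by (simp add: fps_nonneg_def)
next
  case (Suc m)
  define E where "E = log_deriv_power G (n + m) - log_deriv_power G n * log_deriv_power G m"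
  \<comment> \<open>By the product rule \<open>fps_deriv E\<close> also subtracts the term in which
    \<open>log_deriv_power G n\<close> is differentiated. Adding it back gives the third summand,
    which is nonnegative by itself.\<close>
  have "log_deriv_power G (n + Suc m) - log_deriv_power G n * log_deriv_power G (Suc m)
      = fps_deriv E + E * G + fps_deriv (log_deriv_power G n) * log_deriv_power G m"
    by (simp add: E_def algebra_simps)
  moreover have "fps_nonneg E"
    using Suc by (simp add: E_def)
  ultimately show ?case
    using assms
    by (auto intro!: fps_nonneg_add fps_nonneg_mult fps_nonneg_deriv fps_nonneg_log_deriv_power)
qed

lemma fps_deriv_eq_supermult:
  assumes "fps_deriv F = F * G" and "fps_nonneg G" and "fps_nth F 0 \<noteq> 0"
  defines "b \<equiv> \<lambda>n. fact n * fps_nth F n / fps_nth F 0"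
  shows "b n * b m \<le> b (n + m)"
proof -
  have b: "b i = fps_nth (log_deriv_power G i) 0" for i
    using fps_0th_higher_deriv[of i F] higher_fps_deriv_eq[OF assms(1), of i] assms(3)
    by (simp add: b_def nonzero_divide_eq_eq mult.commute)
  have "0 \<le> fps_nth (log_deriv_power G (n + m) - log_deriv_power G n * log_deriv_power G m) 0"
    using log_deriv_power_supermult[OF assms(2)] unfolding fps_nonneg_def by blast
  then show ?thesis
    by (simp add: b)
qed

text \<open>The \<open>n\<close>-th derivative at 0 equals \<open>fps_nth F 0\<close> times the
  constant coefficient of a nonnegative series.\<close>

lemma fps_nonneg_if_deriv_eq:
  assumes F: "fps_deriv F = F * G" and G: "fps_nonneg G" and "fps_nth F 0 \<ge> 0"
  shows "fps_nonneg F"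
proof -
  have "fact n * fps_nth F n \<ge> 0" for n
    using higher_fps_deriv_eq[OF F, of n] assms(3)
      fps_nonneg_log_deriv_power[OF G, of n]
    by (simp add: fps_nonneg_def flip: fps_0th_higher_deriv)
  then show ?thesis
    by (metis fact_gt_zero fps_nonneg_def zero_le_mult_iff not_le)
qed

section \<open>Submultiplicativity passed through a convolution recurrence\<close>

lemma submult_of_recurrence:
  fixes a x :: "nat \<Rightarrow> real"
  assumes a0: "a 0 = 1" and x0: "x 0 = 1" and x_nonneg: "\<And>n. x n \<ge> 0"
    and rec: "\<And>n. real n * a n = (\<Sum>j=1..n. x j * a (n - j))"
    and x: "\<And>n m. x (n + m) \<le> x n * x m"
  shows "a (n + m) \<le> a n * a m"
proof -
  \<comment> \<open>This lets the tail sum below trade \<open>x n\<close> for \<open>a n\<close>.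
    Each of \<open>n\<close> copies of \<open>x n\<close> is split differently, as
    \<open>x j * x (n - j)\<close>, to match the terms of the recurrence.\<close>
  have x_le_a: "x n \<le> a n" for n
  proof (induction n rule: less_induct)
    case (less n)
    show ?case
    proof (cases "n = 0")
      case False
      have "real n * x n = (\<Sum>j=1..n. x n)"
        by simp
      also have "\<dots> \<le> (\<Sum>j=1..n. x j * a (n - j))"
      proof (rule sum_mono)
        fix j assume j: "j \<in> {1..n}"
        have "x n \<le> x j * x (n - j)"
          using x[of j "n - j"] j by simp
        also have "\<dots> \<le> x j * a (n - j)"
          using less[of "n - j"] j x_nonneg by (intro mult_left_mono) auto
        finally show "x n \<le> x j * a (n - j)" .
      qed
      also have "\<dots> = real n * a n"
        by (rule rec[symmetric])
      finally show ?thesis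
        using False by simp
    qed (simp add: a0 x0)
  qed
  then have a_nonneg: "a n \<ge> 0" for n
    using x_nonneg order_trans by blast
  show ?thesis
  proof (induction n rule: less_induct)
    case (less n)
    show ?case
    proof (cases "n = 0")
      case False
      \<comment> \<open>The recurrence is cut at \<open>j = n\<close>. The head is at most
        \<open>n * (a n * a m)\<close> by induction, the tail at most \<open>m * (a n * a m)\<close>
        by submultiplicativity of \<open>x\<close>.\<close>
      have "real (n + m) * a (n + m) = (\<Sum>j=1..n+m. x j * a (n + m - j))"
        by (rule rec)
      also have "\<dots> = (\<Sum>j=1..n. x j * a (n + m - j)) + (\<Sum>j=n+1..n+m. x j * a (n + m - j))"
        by (subst sum.ub_add_nat) auto
      also have "(\<Sum>j=n+1..n+m. x j * a (n + m - j)) = (\<Sum>i=1..m. x (n + i) * a (m - i))"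
        by (rule sum.reindex_bij_witness[of _ "\<lambda>i. n + i" "\<lambda>j. j - n"]) (auto simp: add.commute)
      also have "\<dots> \<le> (\<Sum>i=1..m. a n * (x i * a (m - i)))"
      proof (rule sum_mono)
        fix i
        have "x (n + i) \<le> x n * x i"
          by (rule x)
        also have "\<dots> \<le> a n * x i"
          by (intro mult_right_mono x_le_a x_nonneg)
        finally have "x (n + i) * a (m - i) \<le> (a n * x i) * a (m - i)"
          by (rule mult_right_mono[OF _ a_nonneg])
        then show "x (n + i) * a (m - i) \<le> a n * (x i * a (m - i))"
          by (simp add: mult.assoc)
      qed
      also have "\<dots> = real m * (a n * a m)"
        by (simp add: rec mult.left_commute flip: sum_distrib_left)
      also have "(\<Sum>j=1..n. x j * a (n + m - j)) \<le> (\<Sum>j=1..n. x j * a (n - j) * a m)"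
      proof (rule sum_mono)
        fix j assume j: "j \<in> {1..n}"
        then have "n + m - j = n - j + m" by simp
        then show "x j * a (n + m - j) \<le> x j * a (n - j) * a m"
          using less[of "n - j"] j x_nonneg[of j] by (auto simp: mult.assoc intro!: mult_left_mono)
      qed
      also have "\<dots> = real n * (a n * a m)"
        by (simp only: sum_distrib_right[symmetric] rec[symmetric] mult.assoc[of "real n"])
      finally have "real (n + m) * a (n + m) \<le> real (n + m) * (a n * a m)"
        by (simp add: algebra_simps)
      then show ?thesis
        using False by simp
    qed (simp add: a0)
  qed
qed

section \<open>Power series of the iterated exponentials\<close>

lemma entire_eval_fps_eqD:
  fixes f g :: "'a :: {banach, real_normed_field} fps"
  assumes "fps_conv_radius f = \<infinity>" "fps_conv_radius g = \<infinity>"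
    and eq: "\<And>z. eval_fps f z = eval_fps g z"
  shows "f = g"
proof (rule fps_ext, rule ccontr)
  fix n
  assume n: "fps_nth f n \<noteq> fps_nth g n"
  have sums: "(\<lambda>n. fps_nth (f - g) n * (z - 0) ^ n) sums 0" for z
  proof -
    have "(\<lambda>n. fps_nth h n * z ^ n) sums eval_fps h z" if "fps_conv_radius h = \<infinity>" for h
      unfolding eval_fps_def by (intro summable_sums summable_fps) (simp add: that)
    from sums_diff[OF this[OF assms(1)] this[OF assms(2)]] show ?thesis
      by (simp add: eq ring_distribs)
  qed
  have "fps_nth f 0 = fps_nth g 0"
    using eq[of 0] by (simp add: eval_fps_at_0)
  with n have "n > 0"
    by (cases n) auto
  \<comment> \<open>A nonzero coefficient of positive index would make 0 an isolated zero of
    \<open>f - g\<close>, which however sums to 0 everywhere.\<close>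
  obtain s :: real where "s > 0" and "\<And>z :: 'a. z \<in> cball 0 s - {0} \<Longrightarrow> (0 :: 'a) \<noteq> 0"
    by (rule powser_0_nonzero[OF zero_less_one sums refl, of n]) (use n \<open>n > 0\<close> in auto)
  from this(2)[of "of_real s"] \<open>s > 0\<close> show False
    by simp
qed

definition iter_exp_fps :: "nat \<Rightarrow> real fps" where
  "iter_exp_fps k = Abs_fps (\<lambda>n. bell_numer k n / fact n)"

lemma iter_exp_0 [simp]: "iter_exp 0 x = x"
  by (simp add: iter_exp_def)

lemma iter_exp_Suc [simp]: "iter_exp (Suc k) x = exp (iter_exp k x)"
  by (simp add: iter_exp_def)

lemma iter_exp_fps_sums: "(\<lambda>n. fps_nth (iter_exp_fps k) n * x ^ n) sums iter_exp k x"
  using bell_numer_sums[of k x] by (simp add: iter_exp_fps_def)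

lemma eval_iter_exp_fps: "eval_fps (iter_exp_fps k) = iter_exp k"
  by (rule ext) (simp add: eval_fps_def sums_unique[OF iter_exp_fps_sums, symmetric])

lemma fps_conv_radius_iter_exp_fps: "fps_conv_radius (iter_exp_fps k) = \<infinity>"
proof -
  have "fps_conv_radius (iter_exp_fps k) \<ge> \<infinity>"
    unfolding fps_conv_radius_def
    by (rule conv_radius_geI_ex') (use iter_exp_fps_sums sums_summable in auto)
  then show ?thesis by simp
qed

lemma bell_numer_unique:
  assumes "\<And>x. (\<lambda>n. B n / fact n * x ^ n) sums iter_exp k x"
  shows "bell_numer k = B"
  using ex1_bell_numer[of k] bell_numer_sums[of k] assms by blast

text \<open>The chain rule is applied to the functions; it carries over to the series because all of
  them converge everywhere.\<close>

lemma fps_deriv_iter_exp_fps_Suc: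
  "fps_deriv (iter_exp_fps (Suc k)) = iter_exp_fps (Suc k) * fps_deriv (iter_exp_fps k)"
proof -
  let ?F = "iter_exp_fps (Suc k)" and ?G = "iter_exp_fps k"
  have deriv_iter: "(iter_exp j has_field_derivative eval_fps (fps_deriv (iter_exp_fps j)) x) (at x)"
    for j x
    using has_field_derivative_eval_fps[of x "iter_exp_fps j" UNIV]
    by (simp add: fps_conv_radius_iter_exp_fps eval_iter_exp_fps)
  have radius: "fps_conv_radius (fps_deriv (iter_exp_fps j)) = \<infinity>" for j
    using fps_conv_radius_deriv[of "iter_exp_fps j"] by (simp add: fps_conv_radius_iter_exp_fps)
  have eval: "eval_fps (fps_deriv ?F) x = eval_fps (?F * fps_deriv ?G) x" for x
  proof -
    have "((\<lambda>x. exp (iter_exp k x)) has_field_derivative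
        exp (iter_exp k x) * eval_fps (fps_deriv ?G) x) (at x)"
      by (rule DERIV_fun_exp[OF deriv_iter])
    moreover have "iter_exp (Suc k) = (\<lambda>x. exp (iter_exp k x))"
      by (rule ext) simp
    ultimately have "(iter_exp (Suc k) has_field_derivative
        iter_exp (Suc k) x * eval_fps (fps_deriv ?G) x) (at x)"
      by simp
    from DERIV_unique[OF deriv_iter this] show ?thesis
      by (subst eval_fps_mult)
        (simp_all add: fps_conv_radius_iter_exp_fps radius eval_iter_exp_fps)
  qed
  have rprod: "fps_conv_radius (?F * fps_deriv ?G) = \<infinity>"
    using fps_conv_radius_mult[of ?F "fps_deriv ?G"]
    by (simp add: fps_conv_radius_iter_exp_fps radius)
  show ?thesis
    by (rule entire_eval_fps_eqD) (simp_all add: eval radius rprod)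
qed

lemma iter_exp_fps_nth_0: "fps_nth (iter_exp_fps k) 0 = iter_exp k 0"
  by (simp flip: eval_iter_exp_fps add: eval_fps_at_0)

lemma bell_order_eq:
  "bell_order k n = fact n * fps_nth (iter_exp_fps k) n / fps_nth (iter_exp_fps k) 0"
  by (simp add: bell_order_def iter_exp_fps_nth_0) (simp add: iter_exp_fps_def)

lemma iter_exp_fps_0: "iter_exp_fps 0 = fps_X"
proof -
  have "(\<lambda>n. (if n = 1 then 1 else 0) / fact n * x ^ n) sums x" for x :: real
  proof -
    have "(\<lambda>n. if n = 1 then x else 0) sums x"
      by (rule sums_single)
    also have "(\<lambda>n. if n = 1 then x else 0) = (\<lambda>n. (if n = 1 then 1 else 0) / fact n * x ^ n)"
      by auto
    finally show ?thesis .
  qed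
  then have "bell_numer 0 = (\<lambda>n. if n = 1 then 1 else 0)"
    by (intro bell_numer_unique) simp
  then show ?thesis
    by (auto simp: iter_exp_fps_def fps_eq_iff)
qed

lemma iter_exp_fps_1: "fps_nth (iter_exp_fps 1) n = 1 / fact n"
proof -
  have "bell_numer 1 = (\<lambda>_. 1)"
    by (intro bell_numer_unique) (use exp_converges[where ?'a = real] in \<open>simp add: divide_inverse\<close>)
  then show ?thesis
    by (simp add: iter_exp_fps_def)
qed

lemma iter_exp_nonneg: "iter_exp k 0 \<ge> 0"
  by (cases k) auto

lemma fps_nonneg_iter_exp_fps: "fps_nonneg (iter_exp_fps k)"
proof (induction k)
  case 0
  show ?case by (simp add: iter_exp_fps_0 fps_nonneg_def)
next
  case (Suc k)
  then show ?case
    by (intro fps_nonneg_if_deriv_eq[OF fps_deriv_iter_exp_fps_Suc] fps_nonneg_deriv)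
      (auto simp: iter_exp_fps_nth_0)
qed

lemma iter_exp_ge_2:
  assumes "k \<ge> 2"
  shows "iter_exp k 0 \<ge> 2"
proof -
  obtain j where k: "k = Suc (Suc j)"
    using assms by (metis add_2_eq_Suc le_Suc_ex)
  have "2 \<le> 1 + exp (iter_exp j 0)"
    using iter_exp_nonneg[of j] by simp
  also have "\<dots> \<le> exp (exp (iter_exp j 0))"
    by (rule exp_ge_add_one_self)
  finally show ?thesis
    by (simp add: k)
qed

section \<open>Upper bound by induction on the order\<close>

lemma bell_order_div_fact_submult:
  "bell_order (Suc (Suc k)) (n + m) / fact (n + m)
    \<le> (bell_order (Suc (Suc k)) n / fact n) * (bell_order (Suc (Suc k)) m / fact m)"
\<comment> \<open>The induction starts at order 2: its step needs the iterated exponential at 0 to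
  be at least 2 one level below, and \<open>iter_exp 1 0\<close> is only 1.\<close>
proof (induction k arbitrary: n m)
  define a where "a k n = bell_order (Suc k) n / fact n" for k n
  \<comment> \<open>The formula would give 0 at \<open>n = 0\<close> and break
    \<open>x k (n + 0) \<le> x k n * x k 0\<close>. The recurrence starts at \<open>j = 1\<close>
    and never reads this value.\<close>
  define x where "x k n = (if n = 0 then 1 else real n * fps_nth (iter_exp_fps k) n)" for k n
  have a0: "a k 0 = 1" for k
    by (simp add: a_def bell_order_eq iter_exp_fps_nth_0)
  have a: "a k n = fps_nth (iter_exp_fps (Suc k)) n / iter_exp (Suc k) 0" for k n
    by (simp add: a_def bell_order_eq iter_exp_fps_nth_0)
  have x_nonneg: "x k n \<ge> 0" for k n
    using fps_nonneg_iter_exp_fps[of k] by (simp add: x_def fps_nonneg_def)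
  \<comment> \<open>Coefficients of index \<open>n - 1\<close> are compared in F' = F G;
    differentiation accounts for the shift \<open>j = i + 1\<close>.\<close>
  have rec: "real n * a k n = (\<Sum>j=1..n. x k j * a k (n - j))" for k n
  proof (cases n)
    case (Suc p)
    have "real n * fps_nth (iter_exp_fps (Suc k)) n = fps_nth (fps_deriv (iter_exp_fps (Suc k))) p"
      by (simp add: Suc)
    also have "\<dots> = fps_nth (fps_deriv (iter_exp_fps k) * iter_exp_fps (Suc k)) p"
      by (simp add: fps_deriv_iter_exp_fps_Suc mult.commute)
    also have "\<dots> = (\<Sum>i=0..p. x k (Suc i) * fps_nth (iter_exp_fps (Suc k)) (p - i))"
      by (simp add: fps_mult_nth x_def)
    also have "\<dots> = (\<Sum>j=1..n. x k j * fps_nth (iter_exp_fps (Suc k)) (n - j))"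
      unfolding Suc One_nat_def sum.shift_bounds_cl_Suc_ivl by simp
    finally show ?thesis
      by (simp add: a sum_divide_distrib)
  qed simp
  have step: "a k (n + m) \<le> a k n * a k m"
    if "\<And>n m. n > 0 \<Longrightarrow> m > 0 \<Longrightarrow> x k (n + m) \<le> x k n * x k m" for k n m
  proof (rule submult_of_recurrence[of "a k" "x k"])
    show "x k (n + m) \<le> x k n * x k m" for n m
      using that[of n m] by (cases "n = 0 \<or> m = 0") (auto simp: x_def)
  qed (use a0 x_nonneg rec in \<open>auto simp: x_def\<close>)
  {
    case 0
    have "a 1 (n + m) \<le> a 1 n * a 1 m"
    proof (rule step)
      fix n m :: nat
      assume "n > 0" "m > 0"
      then obtain p q where pq: "n = Suc p" "m = Suc q"
        by (metis gr0_implies_Suc)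
      \<comment> \<open>The factor \<open>i + 1\<close> cancels against \<open>fact (Suc i)\<close>,
        so the claim becomes p! q! \<le> (p + q + 1)!.\<close>
      have x1: "x 1 (Suc i) = 1 / fact i" for i
        by (simp add: x_def iter_exp_fps_1 flip: One_nat_def)
      have "(fact p * fact q :: real) \<le> fact (p + q)"
        by (metis fact_fact_dvd_fact dvd_imp_le fact_gt_zero of_nat_fact of_nat_le_iff of_nat_mult)
      also have "\<dots> \<le> fact (Suc (p + q))"
        by (rule fact_mono) simp
      finally have "1 / fact (Suc (p + q)) \<le> (1 / (fact p * fact q) :: real)"
        by (intro divide_left_mono) auto
      then show "x 1 (n + m) \<le> x 1 n * x 1 m"
        using x1[of "Suc (p + q)"] x1[of p] x1[of q] by (simp add: pq del: fact_Suc One_nat_def)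
    qed
    then show ?case by (simp add: a_def)
  next
    case (Suc k)
    let ?c = "iter_exp (Suc (Suc k)) 0"
    have a_submult: "a (Suc k) (n + m) \<le> a (Suc k) n * a (Suc k) m" for n m
      using Suc by (simp add: a_def)
    have c: "?c \<ge> 2"
      by (rule iter_exp_ge_2) simp
    have x: "x (Suc (Suc k)) n = ?c * (real n * a (Suc k) n)" if "n > 0" for n
      using that c by (simp add: x_def a)
    have a_nonneg: "a (Suc k) n \<ge> 0" for n
      using fps_nonneg_iter_exp_fps[of "Suc (Suc k)"] by (simp add: a fps_nonneg_def)
    have "a (Suc (Suc k)) (n + m) \<le> a (Suc (Suc k)) n * a (Suc (Suc k)) m"
    proof (rule step)
      fix n m :: nat
      assume nm: "n > 0" "m > 0"
      \<comment> \<open>By \<open>x\<close> the product on the right carries \<open>?c\<close> twice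
        and the left side once; the spare \<open>?c\<close> supplies the 2.\<close>
      have "n + m \<le> 2 * n * m"
        using nm by (cases n; cases m) auto
      then have "real n + real m \<le> 2 * (real n * real m)"
        by (metis mult.assoc of_nat_add of_nat_le_iff of_nat_mult of_nat_numeral)
      also have "\<dots> \<le> ?c * (real n * real m)"
        using c by (intro mult_right_mono) auto
      finally have "(real n + real m) * a (Suc k) (n + m)
          \<le> (?c * (real n * real m)) * (a (Suc k) n * a (Suc k) m)"
        using a_submult a_nonneg by (intro mult_mono) auto
      then have "?c * ((real n + real m) * a (Suc k) (n + m))
          \<le> ?c * ((?c * (real n * real m)) * (a (Suc k) n * a (Suc k) m))"
        using c by (intro mult_left_mono) auto
      then show "x (Suc (Suc k)) (n + m) \<le> x (Suc (Suc k)) n * x (Suc (Suc k)) m"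
        using nm by (simp add: x mult_ac del: iter_exp_Suc)
    qed
    then show ?case by (simp add: a_def)
  }
qed

theorem theorem3:
  fixes k :: nat
  assumes "k \<ge> 2"
  shows "\<forall>n m. bell_order k n * bell_order k m \<le> bell_order k (n + m) \<and>
    bell_order k (n + m) \<le> real ((n + m) choose n) * bell_order k n * bell_order k m"
proof (intro allI conjI)
  fix n m
  obtain j where k: "k = Suc (Suc j)"
    using assms by (metis add_2_eq_Suc le_Suc_ex)
  show "bell_order k n * bell_order k m \<le> bell_order k (n + m)"
    unfolding k bell_order_eq
    by (rule fps_deriv_eq_supermult[OF fps_deriv_iter_exp_fps_Suc])
      (auto intro: fps_nonneg_deriv fps_nonneg_iter_exp_fps simp: iter_exp_fps_nth_0)
  have "bell_order k (n + m) = fact (n + m) * (bell_order k (n + m) / fact (n + m))"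
    by simp
  also have "\<dots> \<le> fact (n + m) * ((bell_order k n / fact n) * (bell_order k m / fact m))"
    unfolding k by (intro mult_left_mono bell_order_div_fact_submult) simp
  also have "\<dots> = real ((n + m) choose n) * bell_order k n * bell_order k m"
    by (simp add: binomial_fact)
  finally show "bell_order k (n + m) \<le> real ((n + m) choose n) * bell_order k n * bell_order k m" .
qed

end
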